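(* Let $n \in \mathbb{N}$, $n \ge 1$, let $p(t) = \sum_{k=0}^m a_k t^k \in \mathbb{R}[t]$ with $a_m \neq 0$, and let $x = (x_1,\ldots,x_n) \in \mathbb{R}^n$ have all entries positive. Let $K_x = D_x C_n$ and $\alpha_x = \prod_{k=1}^n x_k$. Then $$p(K_x) = \sum_{r=0}^{n-1} \frac{p_{(r,n)}\left(\alpha_x^{1/n}\right)}{\alpha_x^{r/n}} K_x^r.$$
   Context: $D_x$ is the $n$-by-$n$ diagonal matrix whose $k$th diagonal entry is $x_k$. $C_n$ is the $n$-by-$n$ permutation matrix whose $(i,j)$-entry is $\delta_{\pi(i),j}$ (Kronecker delta), where $\pi$ is the permutation of $\{1,\ldots,n\}$ given by $\pi(i) = (i \bmod n) + 1$. For $r \in \{0,\ldots,n-1\}$, the $r \bmod n$-part of $p$ is $$p_{(r,n)}(t) = \sum_{\substack{0 \le k \le m \\ k \bmod n = r}} a_k t^k,$$ where an empty sum is the zero polynomial. Here $\alpha_x^{1/n}$ and $\alpha_x^{r/n}$ denote positive real powers, and $K_x^0 = I$. *)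

theory Defs
  imports Complex_Main "HOL-Computational_Algebra.Polynomial" "Jordan_Normal_Form.Matrix"
begin

(* Vectors and matrices are 0-based in the library, so the paper's x_k is x $ (k - 1)
   and its (i,j)-entry is A $$ (i - 1, j - 1). *)

definition D_mat :: "real vec \<Rightarrow> real mat" where
  "D_mat x = mat_diag (dim_vec x) (\<lambda>k. x $ k)"

(* The permutation of {1..n}, in 1-based form. *)
definition cyc_perm :: "nat \<Rightarrow> nat \<Rightarrow> nat" where
  "cyc_perm n i = (i mod n) + 1"

definition C_mat :: "nat \<Rightarrow> real mat" where
  "C_mat n = mat n n (\<lambda>(i, j). if cyc_perm n (i + 1) = j + 1 then 1 else 0)"

definition K_mat :: "real vec \<Rightarrow> real mat" where
  "K_mat x = D_mat x * C_mat (dim_vec x)"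

definition alpha :: "real vec \<Rightarrow> real" where
  "alpha x = (\<Prod>k<dim_vec x. x $ k)"

(* The type of matrices is not a monoid under addition (dimensions vary), so sums of
   n-by-n matrices are taken in the module of n-by-n matrices. *)
definition poly_at_mat :: "real poly \<Rightarrow> real mat \<Rightarrow> real mat" where
  "poly_at_mat p A =
     (\<Oplus>\<^bsub>module_mat TYPE(real) (dim_row A) (dim_row A)\<^esub> k\<in>{..degree p}. coeff p k \<cdot>\<^sub>m (A ^\<^sub>m k))"

definition mod_part :: "nat \<Rightarrow> nat \<Rightarrow> real poly \<Rightarrow> real poly" where
  "mod_part r n p = (\<Sum>k\<in>{k. k \<le> degree p \<and> k mod n = r}. monom (coeff p k) k)"

end

theory Submission
  imports Defs
begin

text \<open>\<open>K_x\<close> is a weighted cyclic shift, so the nonzero entries of \<open>K_x\<^sup>k\<close> are products of \<open>k\<close>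
  cyclically consecutive \<open>x_i\<close>. A window of length \<open>n\<close> meets every index once, whence
  \<open>K_x\<^sup>n = \<alpha>_x I\<close>. Therefore \<open>K_x\<^sup>k = \<alpha>_x\<^bsup>k div n\<^esup> K_x\<^bsup>k mod n\<^esup>\<close>, and collecting the terms of
  \<open>p(K_x)\<close> by \<open>r = k mod n\<close> gives the formula, since \<open>k div n = k/n - r/n\<close>.\<close>

text \<open>Taking an entry is additive. This reduces an identity between sums in
  \<open>module_mat\<close> to one scalar identity for each pair \<open>(i, j)\<close>, where
  regrouping is an ordinary rearrangement of real sums.\<close>

lemma index_finsum_mat:
  fixes f :: "'b \<Rightarrow> 'a::comm_ring_1 mat"
  assumes "finite S" "\<And>s. s \<in> S \<Longrightarrow> f s \<in> carrier_mat m n" "i < m" "j < n"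
  shows "(\<Oplus>\<^bsub>module_mat TYPE('a) m n\<^esub> s\<in>S. f s) $$ (i, j) = (\<Sum>s\<in>S. f s $$ (i, j))"
proof -
  interpret abelian_group "module_mat TYPE('a) m n"
    by (rule abelian_group_mat)
  show ?thesis
    using assms(1,2)
  proof (induction S rule: finite_induct)
    case empty
    then show ?case using assms(3,4) by (simp add: module_mat_simps)
  next
    case (insert s S)
    then have "f \<in> S \<rightarrow> carrier (module_mat TYPE('a) m n)"
      by (auto simp: module_mat_simps)
    moreover from this have "finsum (module_mat TYPE('a) m n) f S \<in> carrier_mat m n"
      using finsum_closed by (simp add: module_mat_simps)
    ultimately show ?case
      using insert assms(3,4) by (simp add: module_mat_simps)
  qed
qed

lemma finsum_mat_closed:
  fixes f :: "'b \<Rightarrow> 'a::comm_ring_1 mat"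
  assumes "\<And>s. s \<in> S \<Longrightarrow> f s \<in> carrier_mat m n"
  shows "(\<Oplus>\<^bsub>module_mat TYPE('a) m n\<^esub> s\<in>S. f s) \<in> carrier_mat m n"
proof -
  interpret abelian_group "module_mat TYPE('a) m n"
    by (rule abelian_group_mat)
  show ?thesis
    using finsum_closed[of f S] assms by (auto simp: module_mat_simps)
qed

text \<open>Moving the start from \<open>i\<close> to \<open>Suc i\<close> drops the factor at
  \<open>i mod n\<close> and appends the one at \<open>(i + n) mod n\<close>, which is the same
  factor.\<close>

lemma prod_cyclic_window:
  fixes f :: "nat \<Rightarrow> 'a::comm_monoid_mult"
  assumes "0 < n"
  shows "(\<Prod>l<n. f ((i + l) mod n)) = (\<Prod>l<n. f l)"
proof (induction i)
  case 0
  show ?case by (intro prod.cong) auto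
next
  case (Suc i)
  obtain m where n: "n = Suc m"
    using assms by (cases n) auto
  have "(\<Prod>l<n. f ((Suc i + l) mod n)) = (\<Prod>l<m. f ((i + Suc l) mod n)) * f ((i + n) mod n)"
    by (simp add: n)
  also have "\<dots> = (\<Prod>l<n. f ((i + l) mod n))"
    using mod_add_self2[of i n] unfolding n
    by (subst prod.lessThan_Suc_shift) (simp add: mult.commute)
  finally show ?case using Suc.IH by simp
qed

lemma K_mat_carrier: "x \<in> carrier_vec n \<Longrightarrow> K_mat x \<in> carrier_mat n n"
  by (auto simp: K_mat_def D_mat_def C_mat_def mat_diag_def)

lemma K_mat_index:
  assumes "x \<in> carrier_vec n" "i < n" "j < n"
  shows "K_mat x $$ (i, j) = (if (i + 1) mod n = j then x $ i else 0)"
proof -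
  have "C_mat n \<in> carrier_mat n n" by (simp add: C_mat_def)
  from mat_diag_mult_left[OF this] show ?thesis
    using assms by (auto simp: K_mat_def D_mat_def C_mat_def cyc_perm_def)
qed

lemma K_mat_pow_carrier: "x \<in> carrier_vec n \<Longrightarrow> K_mat x ^\<^sub>m k \<in> carrier_mat n n"
  using K_mat_carrier by (intro pow_carrier_mat) auto

text \<open>In the directed \<open>n\<close>-cycle weighted by \<open>x\<close>, exactly one walk of
  \<open>k\<close> steps leaves \<open>i\<close>. It ends at \<open>(i + k) mod n\<close> and
  collects the weights of the vertices it leaves.\<close>

lemma K_mat_pow_index:
  assumes x: "x \<in> carrier_vec n" and "i < n" "j < n"
  shows "(K_mat x ^\<^sub>m k) $$ (i, j) =
    (if (i + k) mod n = j then \<Prod>l<k. x $ ((i + l) mod n) else 0)"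
  using assms(2,3)
proof (induction k arbitrary: j)
  case 0
  then show ?case using K_mat_carrier[OF x] by auto
next
  case (Suc k)
  let ?P = "\<Prod>l<k. x $ ((i + l) mod n)"
  have n: "0 < n" using Suc.prems by simp
  have "(K_mat x ^\<^sub>m Suc k) $$ (i, j) = (\<Sum>l<n. (K_mat x ^\<^sub>m k) $$ (i, l) * K_mat x $$ (l, j))"
    using Suc.prems K_mat_carrier[OF x] K_mat_pow_carrier[OF x, of k]
    by (simp add: scalar_prod_def atLeast0LessThan)
  \<comment> \<open>By the induction hypothesis at column \<open>l\<close>, only the endpoint of the
    walk of length \<open>k\<close> survives, so the sum is a Kronecker delta in
    \<open>l\<close>.\<close>
  also have "\<dots> = (\<Sum>l<n. if (i + k) mod n = l
      then ?P * (if (l + 1) mod n = j then x $ l else 0) else 0)"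
    using Suc x by (intro sum.cong) (auto simp: K_mat_index)
  also have "\<dots> = ?P * (if ((i + k) mod n + 1) mod n = j then x $ ((i + k) mod n) else 0)"
    using n by (subst sum.delta') auto
  also have "((i + k) mod n + 1) mod n = (i + Suc k) mod n"
    by (simp add: mod_simps)
  finally show ?case by simp
qed

lemma K_mat_pow_add_n:
  assumes "x \<in> carrier_vec n" "i < n" "j < n"
  shows "(K_mat x ^\<^sub>m (k + n)) $$ (i, j) = alpha x * (K_mat x ^\<^sub>m k) $$ (i, j)"
proof -
  \<comment> \<open>The length \<open>m\<close> is kept apart from the modulus \<open>n\<close>, so
    that the induction varies the length alone; \<open>m = n\<close> is used afterwards. The second
    factor is then a full window starting at \<open>i + k\<close>.\<close>
  have "(\<Prod>l<k + m. x $ ((i + l) mod n))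
      = (\<Prod>l<k. x $ ((i + l) mod n)) * (\<Prod>l<m. x $ ((i + k + l) mod n))" for m
    by (induction m) (simp_all add: mult.assoc add.assoc)
  also have "(\<Prod>l<n. x $ ((i + k + l) mod n)) = alpha x"
    using assms by (subst prod_cyclic_window) (auto simp: alpha_def)
  finally show ?thesis
    using assms by (simp add: K_mat_pow_index mult.commute flip: add.assoc)
qed

lemma K_mat_pow_mod:
  assumes "x \<in> carrier_vec n" "i < n" "j < n"
  shows "(K_mat x ^\<^sub>m k) $$ (i, j) = alpha x ^ (k div n) * (K_mat x ^\<^sub>m (k mod n)) $$ (i, j)"
proof -
  have "(K_mat x ^\<^sub>m (r + q * n)) $$ (i, j) = alpha x ^ q * (K_mat x ^\<^sub>m r) $$ (i, j)" for r q
    using K_mat_pow_add_n[OF assms, of "r + _ * n"]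
    by (induction q) (simp_all add: algebra_simps)
  from this[of "k mod n" "k div n"] show ?thesis by simp
qed

lemma powr_quotient:
  fixes a :: real
  assumes "0 < a" "0 < n"
  shows "(a powr (1 / real n)) ^ k / a powr (real (k mod n) / real n) = a ^ (k div n)"
proof -
  have "real k = real (k div n) * real n + real (k mod n)"
    by (metis div_mult_mod_eq of_nat_add of_nat_mult)
  then have "real k / real n = real (k div n) + real (k mod n) / real n"
    using assms by (simp add: field_simps)
  moreover have "(a powr (1 / real n)) ^ k = a powr (real k / real n)"
    using assms by (simp add: powr_powr flip: powr_realpow)
  ultimately show ?thesis
    using assms by (simp add: powr_add powr_realpow)
qed

text \<open>All exponents in the \<open>r\<close>-part have remainder \<open>r\<close>, so the
  common denominator cancels the fractional part of every exponent \<open>k / n\<close>, and only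
  integer powers of \<open>a\<close> remain.\<close>

lemma poly_mod_part_quotient:
  assumes "0 < a" "0 < n"
  shows "poly (mod_part r n p) (a powr (1 / real n)) / a powr (real r / real n)
    = (\<Sum>k\<in>{k. k \<le> degree p \<and> k mod n = r}. coeff p k * a ^ (k div n))"
  unfolding mod_part_def poly_sum sum_divide_distrib
  using assms by (intro sum.cong) (auto simp: poly_monom powr_quotient simp flip: times_divide_eq_right)

theorem theorem4p1:
  fixes n :: nat and p :: "real poly" and x :: "real vec"
  assumes "n \<ge> 1"
    and "p \<noteq> 0"
    and "x \<in> carrier_vec n"
    and "\<forall>k<n. x $ k > 0"
  shows "poly_at_mat p (K_mat x) =
    (\<Oplus>\<^bsub>module_mat TYPE(real) n n\<^esub> r\<in>{..<n}.
       (poly (mod_part r n p) (alpha x powr (1 / real n)) / alpha x powr (real r / real n))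
         \<cdot>\<^sub>m (K_mat x ^\<^sub>m r))"
    (is "_ = (\<Oplus>\<^bsub>_\<^esub> r\<in>_. ?c r \<cdot>\<^sub>m _)")
proof -
  note x = assms(3)
  note pow = K_mat_pow_carrier[OF x]
  let ?M = "module_mat TYPE(real) n n"
  have n: "0 < n" and a: "0 < alpha x"
    using assms by (auto simp: alpha_def intro!: prod_pos)
  have dim: "dim_row (K_mat x) = n"
    using K_mat_carrier[OF x] by simp
  have L: "poly_at_mat p (K_mat x) \<in> carrier_mat n n"
    unfolding poly_at_mat_def dim using pow by (intro finsum_mat_closed) simp
  have R: "(\<Oplus>\<^bsub>?M\<^esub> r\<in>{..<n}. ?c r \<cdot>\<^sub>m (K_mat x ^\<^sub>m r)) \<in> carrier_mat n n"
    using pow by (intro finsum_mat_closed) simp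
  show ?thesis
  proof (rule eq_matI)
    fix i j
    assume "i < dim_row (\<Oplus>\<^bsub>?M\<^esub> r\<in>{..<n}. ?c r \<cdot>\<^sub>m (K_mat x ^\<^sub>m r))"
      and "j < dim_col (\<Oplus>\<^bsub>?M\<^esub> r\<in>{..<n}. ?c r \<cdot>\<^sub>m (K_mat x ^\<^sub>m r))"
    then have ij: "i < n" "j < n" using R by auto
    let ?E = "\<lambda>k. (K_mat x ^\<^sub>m k) $$ (i, j)"
    have entry: "(c \<cdot>\<^sub>m (K_mat x ^\<^sub>m k)) $$ (i, j) = c * ?E k" for c k
      using carrier_matD[OF pow[of k]] ij by (intro index_smult_mat(1)) simp_all
    have "poly_at_mat p (K_mat x) $$ (i, j) = (\<Sum>k\<le>degree p. coeff p k * ?E k)"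
      unfolding poly_at_mat_def dim
      using pow ij by (subst index_finsum_mat) (simp_all add: entry del: index_smult_mat)
    also have "\<dots> = (\<Sum>k\<le>degree p. coeff p k * alpha x ^ (k div n) * ?E (k mod n))"
      by (subst K_mat_pow_mod[OF x ij]) (simp add: mult.assoc)
    \<comment> \<open>The sum is split over the fibres of \<open>k mod n\<close>, which lie in
      \<open>{..<n}\<close> because \<open>n\<close> is positive.\<close>
    also have "\<dots> = (\<Sum>r<n. \<Sum>k\<in>{k. k \<in> {..degree p} \<and> k mod n = r}.
        coeff p k * alpha x ^ (k div n) * ?E (k mod n))"
      using n by (intro sum.group[symmetric]) auto
    \<comment> \<open>On the fibre over \<open>r\<close> the factor \<open>?E (k mod n)\<close> is
      the constant \<open>?E r\<close> and can be pulled out; the remaining inner sum is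
      \<open>?c r\<close>.\<close>
    also have "\<dots> = (\<Sum>r<n. ?c r * ?E r)"
      unfolding poly_mod_part_quotient[OF a n] sum_distrib_right
      by (intro sum.cong) auto
    also have "\<dots> = (\<Oplus>\<^bsub>?M\<^esub> r\<in>{..<n}. ?c r \<cdot>\<^sub>m (K_mat x ^\<^sub>m r)) $$ (i, j)"
      using pow ij by (subst index_finsum_mat) (simp_all add: entry del: index_smult_mat)
    finally show "poly_at_mat p (K_mat x) $$ (i, j)
      = (\<Oplus>\<^bsub>?M\<^esub> r\<in>{..<n}. ?c r \<cdot>\<^sub>m (K_mat x ^\<^sub>m r)) $$ (i, j)" .
  qed (use L R in auto)
qed

end
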